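(* Assume (A2), (A3) and $\rho<0$, and let $\alpha$ be the tail-index. (i) If $\alpha\le1$, then for every $p\in(0,\alpha)$ we have $h(p)<1$ and for all $k\ge1$ $$\mathbb{E}\|x_k\|^p\le (h(p))^k\,\mathbb{E}\|x_0\|^p+\frac{1-(h(p))^k}{1-h(p)}\,\mathbb{E}\|q_1\|^p.$$ (ii) If $\alpha>1$, then for every $p\in(1,\alpha)$ we have $h(p)<1$, and for every $0<\epsilon<\frac{1}{h(p)}-1$ and all $k\ge1$ $$\mathbb{E}\|x_k\|^p\le ((1+\epsilon)h(p))^k\,\mathbb{E}\|x_0\|^p+\frac{1-((1+\epsilon)h(p))^k}{1-(1+\epsilon)h(p)}\cdot\frac{(1+\epsilon)^{\frac{p}{p-1}}-(1+\epsilon)}{\left((1+\epsilon)^{\frac{1}{p-1}}-1\right)^p}\,\mathbb{E}\|q_1\|^p.$$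
   Context: Setup: integers $d,b\ge1$, stepsize $\eta>0$, i.i.d. data $(a_i,y_i)$; $H_k=\sum_{i=b(k-1)+1}^{bk}a_ia_i^T$, $M_k=I_d-\frac{\eta}{b}H_k$, $q_k=\frac{\eta}{b}\sum_{i=b(k-1)+1}^{bk}a_iy_i$, $x_k=M_kx_{k-1}+q_k$ with $x_0$ independent of the data. $\|\cdot\|$ Euclidean/spectral norm. $\Pi_k=M_k\cdots M_1$, $h(s)=\lim_{k\to\infty}(\mathbb{E}\|\Pi_k\|^s)^{1/k}$, $\rho=\lim_{k\to\infty}(2k)^{-1}\log\lambda_{\max}(\Pi_k^T\Pi_k)$. The tail-index $\alpha$ is the unique $\alpha>0$ with $h(\alpha)=1$. Assumptions: (A2) $y_i$ i.i.d. with continuous density supported on $\mathbb{R}$, all moments finite. (A3) $a_i\sim\mathcal{N}(0,\sigma^2I_d)$ i.i.d. *)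

theory Defs
  imports "HOL-Probability.Probability"
begin

definition outer :: "real^'d \<Rightarrow> real^'d^'d" where
  "outer v = (\<chi> r c. v$r * v$c)"

text \<open>Data indices i = 1,2,...; batch k uses indices b(k-1)+1 .. bk.
  Here a, y are realisations (sample point fixed).\<close>
definition Hmat :: "nat \<Rightarrow> (nat \<Rightarrow> real^'d) \<Rightarrow> nat \<Rightarrow> real^'d^'d" where
  "Hmat b a k = (\<Sum>i\<in>{b*(k-1)+1..b*k}. outer (a i))"

definition Mmat :: "nat \<Rightarrow> real \<Rightarrow> (nat \<Rightarrow> real^'d) \<Rightarrow> nat \<Rightarrow> real^'d^'d" where
  "Mmat b \<eta> a k = mat 1 - (\<eta> / real b) *\<^sub>R Hmat b a k"

definition qvec :: "nat \<Rightarrow> real \<Rightarrow> (nat \<Rightarrow> real^'d) \<Rightarrow> (nat \<Rightarrow> real) \<Rightarrow> nat \<Rightarrow> real^'d" where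
  "qvec b \<eta> a y k = (\<eta> / real b) *\<^sub>R (\<Sum>i\<in>{b*(k-1)+1..b*k}. y i *\<^sub>R a i)"

fun xseq :: "nat \<Rightarrow> real \<Rightarrow> (nat \<Rightarrow> real^'d) \<Rightarrow> (nat \<Rightarrow> real) \<Rightarrow> real^'d \<Rightarrow> nat \<Rightarrow> real^'d" where
  "xseq b \<eta> a y x0 0 = x0"
| "xseq b \<eta> a y x0 (Suc k) = Mmat b \<eta> a (Suc k) *v xseq b \<eta> a y x0 k + qvec b \<eta> a y (Suc k)"

fun Piprod :: "nat \<Rightarrow> real \<Rightarrow> (nat \<Rightarrow> real^'d) \<Rightarrow> nat \<Rightarrow> real^'d^'d" where
  "Piprod b \<eta> a 0 = mat 1"
| "Piprod b \<eta> a (Suc k) = Mmat b \<eta> a (Suc k) ** Piprod b \<eta> a k"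

definition specnorm :: "real^'n^'m \<Rightarrow> real" where
  "specnorm A = onorm (\<lambda>v. A *v v)"

definition lambda_max :: "real^'n^'n \<Rightarrow> real" where
  "lambda_max A = Max {l. \<exists>v. v \<noteq> 0 \<and> A *v v = l *\<^sub>R v}"

definition hfun :: "'w measure \<Rightarrow> nat \<Rightarrow> real \<Rightarrow> (nat \<Rightarrow> 'w \<Rightarrow> real^'d) \<Rightarrow> real \<Rightarrow> real" where
  "hfun M b \<eta> a s = lim (\<lambda>k. (integral\<^sup>L M (\<lambda>\<omega>. specnorm (Piprod b \<eta> (\<lambda>i. a i \<omega>) k) powr s)) powr (1 / real k))"

end

theory Submission
  imports Defs
begin

text \<open>
  The Gaussian law is invariant under orthogonal maps, so \<open>E \<parallel>M\<^sub>1 v\<parallel>\<^sup>p = m(p) \<parallel>v\<parallel>\<^sup>p\<close> with a constant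
  \<open>m(p)\<close> that does not depend on the direction of \<open>v\<close>. By independence
  \<open>E \<parallel>\<Pi>\<^sub>k v\<parallel>\<^sup>p = m(p)\<^sup>k \<parallel>v\<parallel>\<^sup>p\<close>, and as the spectral norm is comparable to the largest column norm,
  \<open>h(p) = m(p)\<close>. Weighted AM-GM, \<open>x\<^sup>p \<le> (p/\<alpha>) x\<^sup>\<alpha> + (1 - p/\<alpha>)\<close> with equality only at \<open>x = 1\<close>, then
  gives \<open>h(p) < 1\<close> for \<open>p < \<alpha>\<close>, because \<open>\<parallel>M\<^sub>1 e\<parallel> < 1\<close> with positive probability: small data contract.
  The moment bounds follow by iterating \<open>E \<parallel>x\<^sub>k\<parallel>\<^sup>p \<le> c h(p) E \<parallel>x\<^bsub>k-1\<^esub>\<parallel>\<^sup>p + C E \<parallel>q\<^sub>1\<parallel>\<^sup>p\<close>, where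
  \<open>(u + v)\<^sup>p \<le> c u\<^sup>p + C v\<^sup>p\<close>: here \<open>c = C = 1\<close> if \<open>p \<le> 1\<close>, and convexity of the power function
  provides \<open>c = 1 + \<epsilon>\<close> if \<open>p > 1\<close>.
\<close>

subsection \<open>Power inequalities and orthogonal invariance\<close>

text \<open>Normalise by \<open>u + v\<close>: a fraction in [0,1] is at most its own
  \<open>p\<close>-th power as \<open>p\<close> is at most 1, and the two fractions add up to
  1.\<close>

lemma powr_add_le:
  fixes u v p :: real
  assumes "0 \<le> u" "0 \<le> v" "0 \<le> p" "p \<le> 1"
  shows "(u + v) powr p \<le> u powr p + v powr p"
proof (cases "u + v = 0")
  case False
  then have pos: "u + v > 0" using assms by simp
  have *: "w / (u + v) \<le> (w / (u + v)) powr p" if "0 \<le> w" "w \<le> u + v" for w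
    using powr_mono'[of p 1 "w / (u + v)"] that pos assms by simp
  have "(u + v) powr p = (u + v) powr p * (u / (u + v) + v / (u + v))"
    using pos by (simp add: add_divide_distrib [symmetric])
  also have "\<dots> \<le> (u + v) powr p * ((u / (u + v)) powr p + (v / (u + v)) powr p)"
    using assms by (intro mult_left_mono add_mono *) auto
  also have "\<dots> = u powr p + v powr p"
    using pos assms by (simp add: powr_divide field_simps)
  finally show ?thesis .
qed (use assms in \<open>auto simp: powr_def\<close>)

text \<open>Convexity of the power applied to \<open>u + v\<close> as the mean of
  \<open>t * u\<close> with weight \<open>1 / t\<close> and \<open>t / (t - 1) * v\<close> with
  weight \<open>1 - 1 / t\<close>. The coefficient of \<open>u powr p\<close> is then
  \<open>t powr (p - 1)\<close>, which dictates the choice of \<open>t\<close>.\<close>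

lemma powr_add_le_eps:
  fixes u v p \<epsilon> :: real
  assumes "0 \<le> u" "0 \<le> v" "1 < p" "0 < \<epsilon>"
  shows "(u + v) powr p \<le> (1 + \<epsilon>) * u powr p +
    ((1 + \<epsilon>) powr (p / (p - 1)) - (1 + \<epsilon>)) / ((1 + \<epsilon>) powr (1 / (p - 1)) - 1) powr p * v powr p"
    (is "_ \<le> _ + ?C * _")
proof -
  define t where "t = (1 + \<epsilon>) powr (1 / (p - 1))"
  have t: "t > 1" using assms by (simp add: t_def)
  have tp1: "t powr (p - 1) = 1 + \<epsilon>" using assms by (simp add: t_def powr_powr)
  have tp: "t powr p = (1 + \<epsilon>) * t"
    using t powr_add[of t "p - 1" 1] by (simp add: tp1)
  have ttp: "(1 + \<epsilon>) powr (p / (p - 1)) = (1 + \<epsilon>) * t"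
    using tp assms by (simp add: t_def powr_powr)
  have C: "?C = (1 + \<epsilon>) * (t - 1) / (t - 1) powr p"
    unfolding ttp t_def [symmetric] by (simp add: algebra_simps)
  \<comment> \<open>Convexity is available on the open half-line only, so zero arguments are treated
    apart; \<open>u = 0\<close> amounts to the constant being at least 1.\<close>
  consider "u = 0" | "v = 0" | "u > 0" "v > 0" using assms by linarith
  then show ?thesis
  proof cases
    case 1
    have "(t - 1) powr p \<le> t powr (p - 1) * (t - 1)"
      using t assms powr_mono2[of "p - 1" "t - 1" t] powr_add[of "t - 1" "p - 1" 1] by simp
    then have "1 \<le> ?C" unfolding C using t by (simp add: tp1)
    then show ?thesis using 1 assms mult_right_mono[of 1 ?C "v powr p"] by simp
  next
    case 2
    then show ?thesis using assms mult_right_mono[of 1 "1 + \<epsilon>" "u powr p"] by simp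
  next
    case 3
    have conv: "convex_on {0<..} (\<lambda>x. x powr p)" using assms by (intro powr_convex) simp
    have eq: "(1 - 1 / t) * (t / (t - 1) * v) + 1 / t * (t * u) = u + v"
      using t by (simp add: field_simps)
    have "((1 - 1 / t) * (t / (t - 1) * v) + 1 / t * (t * u)) powr p
       \<le> (1 - 1 / t) * (t / (t - 1) * v) powr p + 1 / t * (t * u) powr p"
      using convex_onD[OF conv, of "1 / t" "t / (t - 1) * v" "t * u"] t 3 by simp
    also have "\<dots> = (1 + \<epsilon>) * u powr p + ?C * v powr p"
      using t assms 3 unfolding C by (simp add: powr_mult powr_divide tp) (simp add: field_simps)
    finally show ?thesis by (simp only: eq)
  qed
qed

text \<open>With \<open>x = exp c\<close>, division by \<open>x powr p\<close> leaves two
  exponentials, each bounded below by its tangent at 0. The weighted tangents sum to 1, and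
  strictness comes from \<open>c\<close> being nonzero.\<close>

lemma powr_less_affine:
  fixes x p s :: real
  assumes "0 \<le> x" "x \<noteq> 1" "0 < p" "p < s"
  shows "x powr p < p / s * x powr s + (1 - p / s)"
proof (cases "x = 0")
  case False
  define c r where "c = ln x" and "r = p / s"
  have c: "c \<noteq> 0" using assms False by (simp add: c_def)
  have r: "0 < r" "r < 1" "r * s = p" using assms by (auto simp: r_def)
  have "r * (1 + (s - p) * c) + (1 - r) * (1 - p * c) < r * exp ((s - p) * c) + (1 - r) * exp (- (p * c))"
    using exp_ge_add_one_self[of "(s - p) * c"] exp_minus_greater[of "p * c"] c r assms
    by (intro add_le_less_mono mult_left_mono mult_strict_left_mono) auto
  also have "r * (1 + (s - p) * c) + (1 - r) * (1 - p * c) = 1 + c * (r * s - p)"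
    by (simp add: algebra_simps)
  finally have "exp (p * c) * 1 < exp (p * c) * (r * exp ((s - p) * c) + (1 - r) * exp (- (p * c)))"
    using r by (intro mult_strict_left_mono) auto
  also have "\<dots> = r * exp (s * c) + (1 - r)"
    by (simp add: distrib_left mult.left_commute[of "exp _"] mult_exp_exp ring_distribs(3,4))
  finally show ?thesis using False by (simp add: powr_def c_def r_def)
qed (use assms in auto)

text \<open>Comparison with the largest term treats exponents below and above 1 alike; the crude
  constant disappears later under \<open>k\<close>-th roots.\<close>

lemma sum_powr_le:
  fixes f :: "'i \<Rightarrow> real"
  assumes "finite I" "\<And>i. i \<in> I \<Longrightarrow> 0 \<le> f i" "0 \<le> p"
  shows "(\<Sum>i\<in>I. f i) powr p \<le> real (card I) powr p * (\<Sum>i\<in>I. f i powr p)"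
proof (cases "I = {}")
  case False
  define m where "m = Max (f ` I)"
  obtain j where j: "j \<in> I" "f j = m"
    using Max_in[of "f ` I"] assms False unfolding m_def by fastforce
  have "(\<Sum>i\<in>I. f i) \<le> real (card I) * m"
    using assms by (intro sum_bounded_above) (auto simp: m_def)
  then have "(\<Sum>i\<in>I. f i) powr p \<le> (real (card I) * m) powr p"
    using assms by (intro powr_mono2) (auto intro: sum_nonneg)
  also have "\<dots> = real (card I) powr p * f j powr p"
    using assms j by (simp add: powr_mult)
  also have "\<dots> \<le> real (card I) powr p * (\<Sum>i\<in>I. f i powr p)"
    using assms j by (intro mult_left_mono member_le_sum) auto
  finally show ?thesis .
qed simp

section \<open>Orthogonal invariance of Lebesgue measure and of the isotropic Gaussian law\<close>

lemma nn_integral_lborel_translate: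
  fixes h :: "'a::euclidean_space \<Rightarrow> ennreal"
  assumes "h \<in> borel_measurable borel"
  shows "(\<integral>\<^sup>+y. h (c + y) \<partial>lborel) = (\<integral>\<^sup>+y. h y \<partial>lborel)"
  using assms nn_integral_distr[of "(+) c" lborel borel h] by (simp add: lborel_distr_plus)

lemma nn_integral_lborel_reflect:
  fixes h :: "'a::euclidean_space \<Rightarrow> ennreal"
  assumes "h \<in> borel_measurable borel"
  shows "(\<integral>\<^sup>+y. h (c - y) \<partial>lborel) = (\<integral>\<^sup>+y. h y \<partial>lborel)"
  using assms nn_integral_distr[of "\<lambda>y. c - y" lborel borel h] lborel_affine[of "-1" c]
  by (simp add: density_1)

lemma open_not_null_lborel:
  fixes U :: "'a::euclidean_space set"
  assumes "open U" "U \<noteq> {}"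
  shows "U \<notin> null_sets lborel"
  using open_not_negligible[OF assms] null_sets_completionI[of U lborel] by (auto simp: negligible_iff_null_sets)

text \<open>Uniqueness of Haar measure, in the form: the image measure \<open>\<mu>\<close> of Lebesgue measure \<open>\<lambda>\<close>
  is translation invariant, so Fubini gives \<open>\<mu> A * \<lambda> B = \<mu> B * \<lambda> A\<close>; now take the unit ball for \<open>B\<close>.\<close>
lemma lborel_distr_orthogonal:
  fixes f :: "'a::euclidean_space \<Rightarrow> 'a"
  assumes f: "orthogonal_transformation f"
  shows "distr lborel borel f = lborel"
proof (rule measure_eqI)
  have lin: "linear f" and nf: "norm (f x) = norm x" for x
    using f by (auto simp: orthogonal_transformation)
  have m [measurable]: "f \<in> borel_measurable borel"
    using lin by (intro borel_measurable_continuous_onI linear_continuous_on) (simp add: linear_linear)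
  have f_inv: "f (inv f y) = y" for y
    using orthogonal_transformation_surj[OF f] by (simp add: surj_f_inv_f)
  fix A assume "A \<in> sets (distr lborel borel f)"
  then have A [measurable]: "A \<in> sets borel" by simp
  let ?B = "ball 0 1 :: 'a set"
  let ?i = "\<lambda>A x. indicator A x :: ennreal"
  have B [measurable]: "?B \<in> sets borel" by simp
  \<comment> \<open>As \<open>f\<close> preserves norms, the ball has the same measure under the
    image measure and under \<open>lborel\<close>, which fixes the proportionality factor at
    1.\<close>
  have fB: "?i ?B (f x) = ?i ?B x" for x by (simp add: indicator_def nf)
  have "emeasure (distr lborel borel f) A = (\<integral>\<^sup>+x. ?i A x \<partial>distr lborel borel f)"
    by simp
  also have "\<dots> = (\<integral>\<^sup>+x. ?i A (f x) \<partial>lborel)" by (subst nn_integral_distr) auto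
  finally have "emeasure (distr lborel borel f) A * emeasure lborel ?B =
      (\<integral>\<^sup>+x. ?i A (f x) * emeasure lborel ?B \<partial>lborel)"
    by (simp add: nn_integral_multc)
  also have "\<dots> = (\<integral>\<^sup>+x. \<integral>\<^sup>+y. ?i A (f x) * ?i ?B (f x + y) \<partial>lborel \<partial>lborel)"
  proof (intro nn_integral_cong)
    fix x
    show "?i A (f x) * emeasure lborel ?B = (\<integral>\<^sup>+y. ?i A (f x) * ?i ?B (f x + y) \<partial>lborel)"
      using nn_integral_lborel_translate[of "?i ?B" "f x"] by (subst nn_integral_cmult) auto
  qed
  also have "\<dots> = (\<integral>\<^sup>+y. \<integral>\<^sup>+x. ?i A (f x) * ?i ?B (f x + y) \<partial>lborel \<partial>lborel)"
    by (rule lborel_pair.Fubini') measurable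
  \<comment> \<open>For fixed \<open>y\<close>, substitute \<open>x - inv f y\<close> for
    \<open>x\<close>; linearity turns \<open>f x\<close> into \<open>f x - y\<close>.\<close>
  also have "\<dots> = (\<integral>\<^sup>+y. \<integral>\<^sup>+x. ?i A (f x - y) * ?i ?B (f x) \<partial>lborel \<partial>lborel)"
  proof (rule nn_integral_cong)
    fix y
    show "(\<integral>\<^sup>+x. ?i A (f x) * ?i ?B (f x + y) \<partial>lborel) = (\<integral>\<^sup>+x. ?i A (f x - y) * ?i ?B (f x) \<partial>lborel)"
      using nn_integral_lborel_translate[of "\<lambda>x. ?i A (f x) * ?i ?B (f x + y)" "- inv f y"]
      by (simp add: linear_add[OF lin] linear_neg[OF lin] linear_diff[OF lin] f_inv algebra_simps)
  qed
  also have "\<dots> = (\<integral>\<^sup>+x. \<integral>\<^sup>+y. ?i A (f x - y) * ?i ?B (f x) \<partial>lborel \<partial>lborel)"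
    by (rule lborel_pair.Fubini') measurable
  also have "\<dots> = emeasure lborel A * emeasure lborel ?B"
  proof -
    have "(\<integral>\<^sup>+y. ?i A (f x - y) * ?i ?B (f x) \<partial>lborel) = emeasure lborel A * ?i ?B x" for x
      using nn_integral_lborel_reflect[of "?i A" "f x"] by (subst nn_integral_multc) (auto simp: fB)
    then show ?thesis by (simp add: nn_integral_cmult)
  qed
  finally have "emeasure (distr lborel borel f) A * emeasure lborel ?B = emeasure lborel A * emeasure lborel ?B" .
  moreover have "emeasure lborel ?B \<noteq> 0" "emeasure lborel ?B \<noteq> \<infinity>"
    using emeasure_bounded_finite[of ?B] open_not_null_lborel[of ?B] by (auto simp: null_sets_def)
  ultimately show "emeasure (distr lborel borel f) A = emeasure lborel A"
    by (simp add: ennreal_mult_cancel_left mult.commute[of _ "emeasure lborel ?B"])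
qed simp

lemma gaussian_density_eq_norm:
  "(\<Prod>j\<in>UNIV. normal_density 0 \<sigma> (v $ j)) =
    (1 / sqrt (2 * pi * \<sigma>\<^sup>2)) ^ CARD('d) * exp (- (norm v)\<^sup>2 / (2 * \<sigma>\<^sup>2))"
  for v :: "real^'d"
  by (simp add: normal_density_def prod.distrib exp_sum [symmetric] prod_dividef sum_divide_distrib sum_negf power_one_over
      norm_vec_def L2_set_def sum_nonneg)

text \<open>The density is a function of the norm alone, hence unchanged by \<open>f\<close>, and so
  is the Lebesgue measure it is taken against.\<close>

lemma gaussian_distr_orthogonal:
  fixes f :: "real^'d \<Rightarrow> real^'d" and \<sigma> :: real
  assumes "orthogonal_transformation f"
  defines "g \<equiv> \<lambda>v::real^'d. ennreal (\<Prod>j\<in>UNIV. normal_density 0 \<sigma> (v $ j))"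
  shows "distr (density lborel g) borel f = density lborel g"
proof -
  have m: "f \<in> borel_measurable borel"
    using assms by (intro borel_measurable_continuous_onI linear_continuous_on)
      (simp add: orthogonal_transformation linear_linear)
  have g [measurable]: "g \<in> borel_measurable borel"
    unfolding g_def gaussian_density_eq_norm by measurable
  have "g (f v) = g v" for v
    using assms(1) by (simp add: g_def gaussian_density_eq_norm orthogonal_transformation)
  then have "distr (density lborel g) borel f = distr (density lborel (\<lambda>v. g (f v))) borel f"
    by simp
  also have "\<dots> = density (distr lborel borel f) g"
    using m by (subst density_distr) auto
  finally show ?thesis using assms(1) by (simp add: lborel_distr_orthogonal)
qed

section \<open>Joint laws of independent families\<close>

lemma (in prob_space) indep_vars_reindex_inj:
  assumes "indep_vars M' X I" "inj_on f J" "f ` J \<subseteq> I"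
  shows "indep_vars (\<lambda>j. M' (f j)) (\<lambda>j. X (f j)) J"
proof -
  \<comment> \<open>Singleton blocks \<open>{f j}\<close> are disjoint by injectivity, so grouping
    them keeps independence; evaluating at \<open>f j\<close> then unpacks each block.\<close>
  have "indep_vars (\<lambda>j. PiM {f j} M') (\<lambda>j \<omega>. restrict (\<lambda>i. X i \<omega>) {f j}) J"
    using assms by (intro indep_vars_restrict) (auto simp: disjoint_family_on_def inj_on_def)
  from indep_vars_compose2[OF this, of "\<lambda>j w. w (f j)" "\<lambda>j. M' (f j)"] show ?thesis by simp
qed

lemma (in prob_space) distr_indep_vars_eq_PiM:
  assumes "indep_vars (\<lambda>_. N) W I" "I \<noteq> {}" "\<And>i. i \<in> I \<Longrightarrow> distr M N (W i) = G"
  shows "distr M (PiM I (\<lambda>_. N)) (\<lambda>\<omega>. \<lambda>i\<in>I. W i \<omega>) = PiM I (\<lambda>_. G)"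
proof -
  have "distr M (PiM I (\<lambda>_. N)) (\<lambda>\<omega>. \<lambda>i\<in>I. W i \<omega>) = PiM I (\<lambda>i. distr M N (W i))"
    using assms by (subst indep_vars_iff_distr_eq_PiM'[symmetric]) (auto simp: indep_vars_def)
  then show ?thesis using assms(3) by (simp cong: PiM_cong)
qed

subsection \<open>Matrices and the recursion for a fixed sample\<close>

lemma fst_borel_measurable: "fst \<in> borel_measurable (borel :: ((real^'d) \<times> real) measure)"
  by (intro borel_measurable_continuous_onI continuous_on_fst continuous_on_id)

lemma snd_borel_measurable: "snd \<in> borel_measurable (borel :: ((real^'d) \<times> real) measure)"
  by (intro borel_measurable_continuous_onI continuous_on_snd continuous_on_id)

text \<open>A rank-one matrix acts through an inner product. Measurability, orthogonal equivariance
  and contraction are all read off this form.\<close>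

lemma Mmat_mult_vec:
  fixes x :: "real^'d"
  shows "Mmat b \<eta> a k *v x = x - (\<eta> / real b) *\<^sub>R (\<Sum>i\<in>{b*(k-1)+1..b*k}. (a i \<bullet> x) *\<^sub>R a i)"
proof -
  have outer: "outer v *v x = (v \<bullet> x) *\<^sub>R v" for v :: "real^'d"
    by (simp add: vec_eq_iff outer_def matrix_vector_mult_def inner_vec_def sum_distrib_right sum_distrib_left mult_ac)
  have "(\<Sum>i\<in>A. outer (a i)) *v x = (\<Sum>i\<in>A. (a i \<bullet> x) *\<^sub>R a i)" for A
    by (induction A rule: infinite_finite_induct) (simp_all add: matrix_vector_mult_add_rdistrib outer)
  then show ?thesis
    by (simp add: Mmat_def Hmat_def matrix_vector_mult_diff_rdistrib scaleR_matrix_vector_assoc [symmetric])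
qed

lemma batch_sum_shift:
  fixes f :: "nat \<Rightarrow> 'a::comm_monoid_add"
  shows "(\<Sum>i\<in>{b*k+1..b*Suc k}. f i) = (\<Sum>i\<in>{1..b}. f (b*k+i))"
  using sum.shift_bounds_cl_nat_ivl[of f 1 "b*k" b] by (simp add: add.commute)

text \<open>Expresses every batch as the first batch of shifted data, so that one law can serve all
  steps.\<close>

lemma Mmat_shift: "Mmat b \<eta> a (Suc k) = Mmat b \<eta> (\<lambda>i. a (b*k+i)) 1"
  using batch_sum_shift[of "\<lambda>i. outer (a i)" b k] by (simp add: Mmat_def Hmat_def)

lemma qvec_shift: "qvec b \<eta> a y (Suc k) = qvec b \<eta> (\<lambda>i. a (b*k+i)) (\<lambda>i. y (b*k+i)) 1"
  using batch_sum_shift[of "\<lambda>i. y i *\<^sub>R a i" b k] by (simp add: qvec_def)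

text \<open>Lets a sample be replaced by its restriction to finitely many indices, an element of a
  finite product space.\<close>

lemma Mmat_cong: "(\<And>i. i \<in> {1..b*k} \<Longrightarrow> a i = a' i) \<Longrightarrow> Mmat b \<eta> a k = Mmat b \<eta> a' k"
  unfolding Mmat_def Hmat_def by (auto intro!: sum.cong arg_cong2[where f=minus] arg_cong2[where f=scaleR])

lemma qvec_cong:
  "(\<And>i. i \<in> {1..b*k} \<Longrightarrow> a i = a' i) \<Longrightarrow> (\<And>i. i \<in> {1..b*k} \<Longrightarrow> y i = y' i) \<Longrightarrow>
    qvec b \<eta> a y k = qvec b \<eta> a' y' k"
  unfolding qvec_def by (auto intro!: sum.cong arg_cong2[where f=scaleR])

lemma xseq_cong:
  "(\<And>i. i \<in> {1..b*k} \<Longrightarrow> a i = a' i) \<Longrightarrow> (\<And>i. i \<in> {1..b*k} \<Longrightarrow> y i = y' i) \<Longrightarrow>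
    xseq b \<eta> a y x k = xseq b \<eta> a' y' x k"
proof (induction k)
  case (Suc k)
  have "xseq b \<eta> a y x k = xseq b \<eta> a' y' x k"
    using Suc.prems by (intro Suc.IH) auto
  moreover have "Mmat b \<eta> a (Suc k) = Mmat b \<eta> a' (Suc k)" "qvec b \<eta> a y (Suc k) = qvec b \<eta> a' y' (Suc k)"
    using Suc.prems by (auto intro!: Mmat_cong qvec_cong)
  ultimately show ?case by simp
qed simp

text \<open>Zero labels make \<open>qvec\<close> vanish, so facts about \<open>xseq\<close> also
  cover the matrix products.\<close>

lemma Piprod_mult_vec: "Piprod b \<eta> a k *v v = xseq b \<eta> a (\<lambda>_. 0) v k"
  by (induction k) (simp_all add: qvec_def matrix_vector_mul_assoc [symmetric])

lemma Mmat_mult_measurable: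
  assumes "\<And>i. i \<in> {1..b*k} \<Longrightarrow> (\<lambda>\<omega>. a i \<omega>) \<in> borel_measurable N" "x \<in> borel_measurable N"
  shows "(\<lambda>\<omega>. Mmat b \<eta> (\<lambda>i. a i \<omega>) k *v x \<omega>) \<in> borel_measurable N"
  unfolding Mmat_mult_vec
  using assms by (intro borel_measurable_diff borel_measurable_scaleR borel_measurable_sum borel_measurable_inner) auto

lemma qvec_measurable:
  assumes "\<And>i. i \<in> {1..b*k} \<Longrightarrow> a i \<in> borel_measurable N"
    "\<And>i. i \<in> {1..b*k} \<Longrightarrow> y i \<in> borel_measurable N"
  shows "(\<lambda>\<omega>. qvec b \<eta> (\<lambda>i. a i \<omega>) (\<lambda>i. y i \<omega>) k) \<in> borel_measurable N"
  unfolding qvec_def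
  using assms by (intro borel_measurable_scaleR borel_measurable_sum) auto

lemma xseq_measurable:
  assumes "\<And>i. i \<in> {1..b*k} \<Longrightarrow> a i \<in> borel_measurable N"
    "\<And>i. i \<in> {1..b*k} \<Longrightarrow> y i \<in> borel_measurable N" "x \<in> borel_measurable N"
  shows "(\<lambda>\<omega>. xseq b \<eta> (\<lambda>i. a i \<omega>) (\<lambda>i. y i \<omega>) (x \<omega>) k) \<in> borel_measurable N"
  using assms
proof (induction k)
  case (Suc k)
  then show ?case
    by (simp del: mult_Suc_right, intro borel_measurable_add Mmat_mult_measurable qvec_measurable Suc.IH) auto
qed simp

lemma norm_powr_measurable [measurable (raw)]:
  fixes f :: "'w \<Rightarrow> 'a::real_normed_vector"
  assumes "f \<in> borel_measurable N"
  shows "(\<lambda>\<omega>. ennreal (norm (f \<omega>) powr p)) \<in> borel_measurable N"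
  using assms by measurable

section \<open>Spectral norm: bounds by columns and measurability\<close>

lemma specnorm_bound: "norm (A *v v) \<le> specnorm A * norm v"
  unfolding specnorm_def by (rule onorm) (simp add: linear_linear)

lemma specnorm_nonneg: "specnorm A \<ge> 0"
  unfolding specnorm_def by (rule onorm_pos_le) (simp add: linear_linear)

lemma specnorm_le_sum_columns: "specnorm A \<le> (\<Sum>j\<in>UNIV. norm (A *v axis j 1))"
  unfolding specnorm_def
proof (rule onorm_le)
  fix v
  have "A *v v = (\<Sum>j\<in>UNIV. (v $ j) *\<^sub>R (A *v axis j 1))"
    by (subst matrix_mult_sum) (simp add: scalar_mult_eq_scaleR matrix_vector_mult_basis)
  also have "norm \<dots> \<le> (\<Sum>j\<in>UNIV. norm v * norm (A *v axis j 1))"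
    by (intro sum_norm_le) (simp add: mult_right_mono component_le_norm_cart)
  finally show "norm (A *v v) \<le> (\<Sum>j\<in>UNIV. norm (A *v axis j 1)) * norm v"
    by (simp add: sum_distrib_left mult.commute)
qed

text \<open>A convex function on a finite-dimensional space is continuous, and a norm is
  convex.\<close>

lemma specnorm_measurable [measurable]: "specnorm \<in> borel_measurable borel"
proof (intro borel_measurable_continuous_onI convex_on_continuous open_UNIV)
  show "convex_on UNIV (specnorm :: real^'n^'m \<Rightarrow> real)"
  proof (rule convex_onI)
    fix t :: real and A B :: "real^'n^'m" assume "0 < t" "t < 1"
    then show "specnorm ((1 - t) *\<^sub>R A + t *\<^sub>R B) \<le> (1 - t) * specnorm A + t * specnorm B"
      using onorm_triangle[of "\<lambda>v. (1 - t) *\<^sub>R (A *v v)" "\<lambda>v. t *\<^sub>R (B *v v)"]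
        onorm_scaleR[of "(*v) A" "1 - t"] onorm_scaleR[of "(*v) B" t]
      by (simp add: specnorm_def linear_linear matrix_vector_mult_add_rdistrib linear_compose_scale_right
          scaleR_matrix_vector_assoc [symmetric])
  qed simp
qed

text \<open>The entries are coordinates of images of the standard basis vectors. This transfers
  measurability from the vector recursion to \<open>Piprod\<close>.\<close>

lemma borel_measurable_matrix:
  fixes A :: "'w \<Rightarrow> real^'n^'m"
  assumes "\<And>v. (\<lambda>\<omega>. A \<omega> *v v) \<in> borel_measurable N"
  shows "A \<in> borel_measurable N"
proof -
  have "(\<lambda>\<omega>. A \<omega> $ i $ j) \<in> borel_measurable N" for i j
  proof -
    have "(\<lambda>\<omega>. (A \<omega> *v axis j 1) $ i) \<in> borel_measurable N"
      using measurable_compose[OF assms borel_measurable_nth] .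
    then show ?thesis by (simp add: matrix_vector_mult_basis column_def)
  qed
  then show ?thesis
    by (subst borel_measurable_euclidean_space) (auto simp: Basis_vec_def inner_axis)
qed

subsection \<open>Moments under Gaussian data\<close>

locale gaussian_sgd = prob_space M for M :: "'w measure" +
  fixes a :: "nat \<Rightarrow> 'w \<Rightarrow> real^'d"
    and y :: "nat \<Rightarrow> 'w \<Rightarrow> real"
    and x0 :: "'w \<Rightarrow> real^'d"
    and b :: nat and \<eta> \<sigma> :: real
  assumes b: "b \<ge> 1" and eta: "\<eta> > 0" and sigma: "\<sigma> > 0"
    and indep: "indep_vars (\<lambda>_. borel)
                  (\<lambda>i \<omega>. if i = 0 then (x0 \<omega>, 0) else (a i \<omega>, y i \<omega>)) UNIV"
    and ident: "\<And>i. i \<ge> 1 \<Longrightarrow>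
                  distr M borel (\<lambda>\<omega>. (a i \<omega>, y i \<omega>)) = distr M borel (\<lambda>\<omega>. (a 1 \<omega>, y 1 \<omega>))"
    and gaussian: "\<And>i. i \<ge> 1 \<Longrightarrow> distributed M lborel (a i)
                  (\<lambda>v. ennreal (\<Prod>j\<in>UNIV. normal_density 0 \<sigma> (v $ j)))"
begin

text \<open>Padding the initial value with a zero label gives all indices one value type, so a
  single independent family holds \<open>x0\<close> and the data.\<close>

definition Z :: "nat \<Rightarrow> 'w \<Rightarrow> (real^'d) \<times> real" where
  "Z i \<omega> = (if i = 0 then (x0 \<omega>, 0) else (a i \<omega>, y i \<omega>))"

lemma indep_Z: "indep_vars (\<lambda>_. borel) Z UNIV"
  using indep by (simp add: Z_def [abs_def])

lemma measurable_Z [measurable]: "Z i \<in> borel_measurable M"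
  using indep_Z by (auto simp: indep_vars_def)

lemma measurable_a: "i \<ge> 1 \<Longrightarrow> a i \<in> borel_measurable M"
  using gaussian[of i] by (auto dest: distributed_measurable)

lemma measurable_y: "i \<ge> 1 \<Longrightarrow> y i \<in> borel_measurable M"
proof -
  assume "i \<ge> 1"
  have "(\<lambda>\<omega>. snd (Z i \<omega>)) \<in> borel_measurable M"
    by (rule measurable_compose[OF measurable_Z snd_borel_measurable])
  then show ?thesis using \<open>i \<ge> 1\<close> by (simp add: Z_def)
qed

lemma measurable_x0: "x0 \<in> borel_measurable M"
proof -
  have "(\<lambda>\<omega>. fst (Z 0 \<omega>)) \<in> borel_measurable M"
    by (rule measurable_compose[OF measurable_Z fst_borel_measurable])
  then show ?thesis by (simp add: Z_def)
qed

section \<open>Stationarity and independence of batches\<close>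

lemma batch_distr:
  "distr M (PiM {1..b} (\<lambda>_. borel)) (\<lambda>\<omega>. \<lambda>j\<in>{1..b}. Z (n + j) \<omega>) =
   distr M (PiM {1..b} (\<lambda>_. borel)) (\<lambda>\<omega>. \<lambda>j\<in>{1..b}. Z j \<omega>)"
proof -
  have "indep_vars (\<lambda>_. borel) (\<lambda>j. Z (n + j)) {1..b}" for n
    using indep_vars_reindex_inj[OF indep_Z, of "(+) n" "{1..b}"] by simp
  \<comment> \<open>Since \<open>j\<close> starts at 1, \<open>n + j\<close> never hits index 0,
    which carries the law of the initial value.\<close>
  moreover have "distr M borel (Z (n + j)) = distr M borel (Z 1)" if "j \<in> {1..b}" for n j
    using ident[of "n + j"] that by (simp add: Z_def [abs_def])
  ultimately have "distr M (PiM {1..b} (\<lambda>_. borel)) (\<lambda>\<omega>. \<lambda>j\<in>{1..b}. Z (n + j) \<omega>) =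
      PiM {1..b} (\<lambda>_. distr M borel (Z 1))" for n
    using b by (intro distr_indep_vars_eq_PiM) auto
  from this[of n] this[of 0] show ?thesis by simp
qed

text \<open>The past up to index \<open>n\<close> is independent of the next \<open>b\<close>
  indices, so the joint law is a product; by stationarity its second factor is the law of the first
  batch, here an independent copy on the sample point \<open>\<omega>'\<close>.\<close>

lemma nn_integral_next_batch:
  assumes G: "G \<in> borel_measurable (PiM {..n} (\<lambda>_. borel))"
    and F: "F \<in> borel_measurable (borel \<Otimes>\<^sub>M PiM {1..b} (\<lambda>_. borel))"
    and X: "\<And>\<omega>. X \<omega> = (G (\<lambda>i\<in>{..n}. Z i \<omega>) :: real^'d)"
  shows "(\<integral>\<^sup>+\<omega>. F (X \<omega>, \<lambda>j\<in>{1..b}. Z (n + j) \<omega>) \<partial>M) =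
    (\<integral>\<^sup>+\<omega>. \<integral>\<^sup>+\<omega>'. F (X \<omega>, \<lambda>j\<in>{1..b}. Z j \<omega>') \<partial>M \<partial>M)"
proof -
  let ?P = "PiM {1..b} (\<lambda>_. borel :: ((real^'d) \<times> real) measure)"
  let ?W = "\<lambda>n \<omega>. \<lambda>j\<in>{1..b}. Z (n + j) \<omega>"
  let ?Q = "PiM {..n} (\<lambda>_. borel :: ((real^'d) \<times> real) measure)"
  let ?V = "\<lambda>\<omega>. \<lambda>i\<in>{..n}. Z i \<omega>"
  have W [measurable]: "?W m \<in> measurable M ?P" for m
    by (intro measurable_restrict) simp
  have V [measurable]: "?V \<in> measurable M ?Q"
    by (intro measurable_restrict) simp
  have "indep_var ?Q ?V
      (PiM {n+1..n+b} (\<lambda>_. borel)) (\<lambda>\<omega>. \<lambda>i\<in>{n+1..n+b}. Z i \<omega>)"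
    by (intro indep_var_restrict[OF indep_Z]) auto
  moreover have "(\<lambda>w. \<lambda>j\<in>{1..b}. w (n + j)) \<in> measurable (PiM {n+1..n+b} (\<lambda>_. borel)) ?P"
    by (intro measurable_restrict measurable_component_singleton) auto
  ultimately have "indep_var ?Q (id \<circ> ?V) ?P
      ((\<lambda>w. \<lambda>j\<in>{1..b}. w (n + j)) \<circ> (\<lambda>\<omega>. \<lambda>i\<in>{n+1..n+b}. Z i \<omega>))"
    by (intro indep_var_compose) auto
  also have "(\<lambda>w. \<lambda>j\<in>{1..b}. w (n + j)) \<circ> (\<lambda>\<omega>. \<lambda>i\<in>{n+1..n+b}. Z i \<omega>) = ?W n"
    by (auto simp: fun_eq_iff restrict_def)
  finally have *: "distr M ?Q ?V \<Otimes>\<^sub>M distr M ?P (?W n) = distr M (?Q \<Otimes>\<^sub>M ?P) (\<lambda>\<omega>. (?V \<omega>, ?W n \<omega>))"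
    unfolding indep_var_distribution_eq id_comp by blast
  \<comment> \<open>Supplies the sigma-finiteness needed to write the product integral as an
    iterated one.\<close>
  interpret W: prob_space "distr M ?P (?W 0)" by (rule prob_space_distr) simp
  note [measurable] = G F
  have [measurable]: "(\<lambda>z. F (G (fst z), snd z)) \<in> borel_measurable (?Q \<Otimes>\<^sub>M ?P)"
    by measurable
  have "(\<integral>\<^sup>+\<omega>. F (X \<omega>, ?W n \<omega>) \<partial>M) =
      (\<integral>\<^sup>+z. F (G (fst z), snd z) \<partial>distr M (?Q \<Otimes>\<^sub>M ?P) (\<lambda>\<omega>. (?V \<omega>, ?W n \<omega>)))"
    by (subst nn_integral_distr) (auto simp: X simp del: One_nat_def)
  also have "\<dots> = (\<integral>\<^sup>+z. F (G (fst z), snd z) \<partial>(distr M ?Q ?V \<Otimes>\<^sub>M distr M ?P (?W 0)))"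
    using batch_distr[of n] by (simp add: * [symmetric] del: One_nat_def)
  also have "\<dots> = (\<integral>\<^sup>+v. \<integral>\<^sup>+w. F (G v, w) \<partial>distr M ?P (?W 0) \<partial>distr M ?Q ?V)"
    by (subst W.nn_integral_fst [symmetric]) (auto simp del: One_nat_def)
  also have "\<dots> = (\<integral>\<^sup>+v. \<integral>\<^sup>+\<omega>'. F (G v, ?W 0 \<omega>') \<partial>M \<partial>distr M ?Q ?V)"
    by (intro nn_integral_cong nn_integral_distr) (auto simp del: One_nat_def)
  also have "\<dots> = (\<integral>\<^sup>+\<omega>. \<integral>\<^sup>+\<omega>'. F (X \<omega>, ?W 0 \<omega>') \<partial>M \<partial>M)"
    by (subst nn_integral_distr) (auto simp: X simp del: One_nat_def)
  finally show ?thesis by simp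
qed

lemma indep_a: "indep_vars (\<lambda>_. borel) a {1..b}"
proof -
  have "indep_vars (\<lambda>_. borel) (\<lambda>i \<omega>. fst (Z i \<omega>)) {1..b}"
    using indep_vars_compose2[OF indep_vars_subset[OF indep_Z], of "{1..b}" "\<lambda>_. fst" "\<lambda>_. borel"] fst_borel_measurable by simp
  also have "?this \<longleftrightarrow> indep_vars (\<lambda>_. borel) a {1..b}"
    by (intro indep_vars_cong) (auto simp: Z_def)
  finally show ?thesis .
qed

text \<open>For a unit vector this is the constant \<open>m(p)\<close>. The extended values keep an
  infinite moment distinguishable from 0.\<close>

definition moment :: "real \<Rightarrow> real^'d \<Rightarrow> ennreal" where
  "moment p v = (\<integral>\<^sup>+\<omega>. ennreal (norm (Mmat b \<eta> (\<lambda>i. a i \<omega>) 1 *v v) powr p) \<partial>M)"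

text \<open>Rotating both the data and the vector rotates the result, which keeps its norm; rotating
  the data alone does not change their joint law.\<close>

lemma moment_orthogonal:
  assumes f: "orthogonal_transformation f"
  shows "moment p (f v) = moment p v"
proof -
  let ?P = "PiM {1..b} (\<lambda>_. borel :: (real^'d) measure)"
  let ?g = "density lborel (\<lambda>v::real^'d. ennreal (\<Prod>j\<in>UNIV. normal_density 0 \<sigma> (v $ j)))"
  have lin: "linear f" and nf: "norm (f x) = norm x" for x
    using f by (auto simp: orthogonal_transformation)
  have inner: "f u \<bullet> f w = u \<bullet> w" for u w using f by (simp add: orthogonal_transformation_def)
  have mf [measurable]: "f \<in> borel_measurable borel"
    using lin by (intro borel_measurable_continuous_onI linear_continuous_on) (simp add: linear_linear)
  note ia = indep_a
  have ifa: "indep_vars (\<lambda>_. borel) (\<lambda>i \<omega>. f (a i \<omega>)) {1..b}"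
    using indep_vars_compose2[OF ia, of "\<lambda>_. f" "\<lambda>_. borel"] by simp
  have ga: "distr M borel (a i) = ?g" if "i \<in> {1..b}" for i
    using distributed_distr_eq_density[OF gaussian[of i]] that by (simp cong: distr_cong)
  have gfa: "distr M borel (\<lambda>\<omega>. f (a i \<omega>)) = ?g" if "i \<in> {1..b}" for i
  proof -
    have "distr M borel (\<lambda>\<omega>. f (a i \<omega>)) = distr (distr M borel (a i)) borel f"
      using measurable_a[of i] that by (subst distr_distr) (auto simp: comp_def)
    then show ?thesis using ga[OF that] gaussian_distr_orthogonal[OF f, of \<sigma>] by simp
  qed
  define F where "F w = ennreal (norm (Mmat b \<eta> w 1 *v f v) powr p)" for w
  have F [measurable]: "F \<in> borel_measurable ?P"
    unfolding F_def by (intro norm_powr_measurable Mmat_mult_measurable) auto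
  have F_cong: "F w = F w'" if "\<And>i. i \<in> {1..b} \<Longrightarrow> w i = w' i" for w w'
    using Mmat_cong[of b 1 w w' \<eta>] that by (simp add: F_def)
  \<comment> \<open>The right-hand side does not mention \<open>W\<close>, so the original and the
    rotated batch give equal integrals.\<close>
  have law: "(\<integral>\<^sup>+\<omega>. F (\<lambda>i. W i \<omega>) \<partial>M) = (\<integral>\<^sup>+w. F w \<partial>PiM {1..b} (\<lambda>_. ?g))"
    if "indep_vars (\<lambda>_. borel) W {1..b}" "\<And>i. i \<in> {1..b} \<Longrightarrow> distr M borel (W i) = ?g" for W
  proof -
    have "(\<lambda>\<omega>. \<lambda>i\<in>{1..b}. W i \<omega>) \<in> measurable M ?P"
      using that(1) by (intro measurable_restrict) (auto simp: indep_vars_def)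
    then have "(\<integral>\<^sup>+w. F w \<partial>PiM {1..b} (\<lambda>_. ?g)) = (\<integral>\<^sup>+\<omega>. F (\<lambda>i\<in>{1..b}. W i \<omega>) \<partial>M)"
      using b by (subst distr_indep_vars_eq_PiM[OF that(1) _ that(2), symmetric]) (auto simp: nn_integral_distr simp del: One_nat_def)
    also have "\<dots> = (\<integral>\<^sup>+\<omega>. F (\<lambda>i. W i \<omega>) \<partial>M)"
      by (intro nn_integral_cong F_cong) simp
    finally show ?thesis by simp
  qed
  have "moment p (f v) = (\<integral>\<^sup>+\<omega>. F (\<lambda>i. f (a i \<omega>)) \<partial>M)"
    using law[OF ia ga] law[OF ifa gfa] by (simp add: moment_def F_def)
  also have "Mmat b \<eta> (\<lambda>i. f (a i \<omega>)) 1 *v f v = f (Mmat b \<eta> (\<lambda>i. a i \<omega>) 1 *v v)" for \<omega>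
    by (simp add: Mmat_mult_vec inner linear_diff[OF lin] linear_scale[OF lin] linear_sum[OF lin])
  then have "(\<integral>\<^sup>+\<omega>. F (\<lambda>i. f (a i \<omega>)) \<partial>M) = moment p v"
    by (simp add: moment_def F_def nf)
  finally show ?thesis .
qed

text \<open>An orthogonal map carries \<open>norm v *\<^sub>R e\<close> to \<open>v\<close>;
  homogeneity then extracts the length.\<close>

lemma moment_isotropic:
  assumes e: "norm e = 1" and p: "0 < p"
  shows "moment p v = moment p e * ennreal (norm v powr p)"
proof -
  obtain f where f: "orthogonal_transformation f" "f (norm v *\<^sub>R e) = v"
    using orthogonal_transformation_exists[of "norm v *\<^sub>R e" v] e by auto
  have "moment p v = moment p (norm v *\<^sub>R e)"
    using moment_orthogonal[OF f(1), of p "norm v *\<^sub>R e"] f(2) by simp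
  also have "\<dots> = (\<integral>\<^sup>+\<omega>. ennreal (norm (Mmat b \<eta> (\<lambda>i. a i \<omega>) 1 *v e) powr p) * ennreal (norm v powr p) \<partial>M)"
    unfolding moment_def
    by (intro nn_integral_cong) (simp add: matrix_vector_mult_scaleR powr_mult ennreal_mult mult.commute)
  also have "\<dots> = moment p e * ennreal (norm v powr p)"
    unfolding moment_def using measurable_a
    by (intro nn_integral_multc norm_powr_measurable Mmat_mult_measurable) auto
  finally show ?thesis .
qed

text \<open>Freezing the past makes the inner integral \<open>moment p (X \<omega>)\<close>, and
  isotropy replaces it by a constant times \<open>norm (X \<omega>) powr p\<close>, whatever the
  direction of \<open>X \<omega>\<close>.\<close>

lemma nn_integral_Mmat_step:
  assumes G: "G \<in> borel_measurable (PiM {..b * k} (\<lambda>_. borel))"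
    and X: "\<And>\<omega>. X \<omega> = G (\<lambda>i\<in>{..b * k}. Z i \<omega>)"
    and e: "norm e = 1" and p: "0 < p"
  shows "(\<integral>\<^sup>+\<omega>. ennreal (norm (Mmat b \<eta> (\<lambda>i. a i \<omega>) (Suc k) *v X \<omega>) powr p) \<partial>M) =
    moment p e * (\<integral>\<^sup>+\<omega>. ennreal (norm (X \<omega>) powr p) \<partial>M)"
proof -
  let ?P = "PiM {1..b} (\<lambda>_. borel :: ((real^'d) \<times> real) measure)"
  define F where "F z = ennreal (norm (Mmat b \<eta> (\<lambda>i. fst (snd z i)) 1 *v fst z) powr p)"
    for z :: "(real^'d) \<times> (nat \<Rightarrow> (real^'d) \<times> real)"
  have F: "F \<in> borel_measurable (borel \<Otimes>\<^sub>M ?P)"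
    unfolding F_def
    by (intro norm_powr_measurable Mmat_mult_measurable measurable_compose[OF _ fst_borel_measurable]) auto
  have F_eq: "F (x, \<lambda>j\<in>{1..b}. Z (n + j) \<omega>) = ennreal (norm (Mmat b \<eta> (\<lambda>i. a (n + i) \<omega>) 1 *v x) powr p)" for x n \<omega>
    using Mmat_cong[of b 1 "\<lambda>i. fst ((\<lambda>j\<in>{1..b}. Z (n + j) \<omega>) i)" "\<lambda>i. a (n + i) \<omega>" \<eta>]
    by (simp add: F_def Z_def)
  have "(\<lambda>\<omega>. \<lambda>i\<in>{..b * k}. Z i \<omega>) \<in> measurable M (PiM {..b * k} (\<lambda>_. borel))"
    by (intro measurable_restrict) simp
  from measurable_compose[OF this G] have Xm: "X \<in> borel_measurable M" by (simp add: X [symmetric])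
  have "(\<integral>\<^sup>+\<omega>. ennreal (norm (Mmat b \<eta> (\<lambda>i. a i \<omega>) (Suc k) *v X \<omega>) powr p) \<partial>M) =
      (\<integral>\<^sup>+\<omega>. F (X \<omega>, \<lambda>j\<in>{1..b}. Z (b * k + j) \<omega>) \<partial>M)"
    unfolding F_eq by (subst Mmat_shift) simp
  also have "\<dots> = (\<integral>\<^sup>+\<omega>. \<integral>\<^sup>+\<omega>'. F (X \<omega>, \<lambda>j\<in>{1..b}. Z j \<omega>') \<partial>M \<partial>M)"
    by (rule nn_integral_next_batch[OF G F X])
  also have "\<dots> = (\<integral>\<^sup>+\<omega>. moment p (X \<omega>) \<partial>M)"
    using F_eq[of _ 0] by (simp add: moment_def)
  also have "\<dots> = moment p e * (\<integral>\<^sup>+\<omega>. ennreal (norm (X \<omega>) powr p) \<partial>M)"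
    unfolding moment_isotropic[OF e p, of "X _"] using Xm by (intro nn_integral_cmult) measurable
  finally show ?thesis .
qed

lemma nn_integral_qvec_stationary:
  "(\<integral>\<^sup>+\<omega>. ennreal (norm (qvec b \<eta> (\<lambda>i. a i \<omega>) (\<lambda>i. y i \<omega>) (Suc k)) powr p) \<partial>M) =
   (\<integral>\<^sup>+\<omega>. ennreal (norm (qvec b \<eta> (\<lambda>i. a i \<omega>) (\<lambda>i. y i \<omega>) 1) powr p) \<partial>M)"
proof -
  let ?P = "PiM {1..b} (\<lambda>_. borel :: ((real^'d) \<times> real) measure)"
  define F where "F w = ennreal (norm (qvec b \<eta> (\<lambda>i. fst (w i)) (\<lambda>i. snd (w i)) 1) powr p)"
    for w :: "nat \<Rightarrow> (real^'d) \<times> real"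
  have F: "F \<in> borel_measurable ?P"
    unfolding F_def
    by (intro norm_powr_measurable qvec_measurable measurable_compose[OF _ fst_borel_measurable] measurable_compose[OF _ snd_borel_measurable]) auto
  have W: "(\<lambda>\<omega>. \<lambda>j\<in>{1..b}. Z (n + j) \<omega>) \<in> measurable M ?P" for n
    by (intro measurable_restrict) simp
  have F_eq: "F (\<lambda>j\<in>{1..b}. Z (n + j) \<omega>) = ennreal (norm (qvec b \<eta> (\<lambda>i. a (n + i) \<omega>) (\<lambda>i. y (n + i) \<omega>) 1) powr p)" for n \<omega>
    using qvec_cong[of b 1 "\<lambda>i. fst ((\<lambda>j\<in>{1..b}. Z (n + j) \<omega>) i)" "\<lambda>i. a (n + i) \<omega>"
        "\<lambda>i. snd ((\<lambda>j\<in>{1..b}. Z (n + j) \<omega>) i)" "\<lambda>i. y (n + i) \<omega>" \<eta>]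
    by (simp add: F_def Z_def)
  have "(\<integral>\<^sup>+\<omega>. F (\<lambda>j\<in>{1..b}. Z (b * k + j) \<omega>) \<partial>M) = (\<integral>\<^sup>+\<omega>. F (\<lambda>j\<in>{1..b}. Z (0 + j) \<omega>) \<partial>M)"
    using F batch_distr[of "b * k"] nn_integral_distr[OF W[of "b * k"], of F] nn_integral_distr[OF W[of 0], of F] by simp
  then show ?thesis
    unfolding F_eq by (subst qvec_shift) simp
qed

lemma nn_integral_Piprod:
  assumes e: "norm e = 1" and p: "0 < p"
  shows "(\<integral>\<^sup>+\<omega>. ennreal (norm (Piprod b \<eta> (\<lambda>i. a i \<omega>) k *v v) powr p) \<partial>M) =
    moment p e ^ k * ennreal (norm v powr p)"
proof (induction k)
  case 0
  then show ?case by (simp add: emeasure_space_1)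
next
  case (Suc k)
  define G where "G w = xseq b \<eta> (\<lambda>i. fst (w i)) (\<lambda>_. 0) v k" for w :: "nat \<Rightarrow> (real^'d) \<times> real"
  have G: "G \<in> borel_measurable (PiM {..b * k} (\<lambda>_. borel))"
    unfolding G_def by (intro xseq_measurable measurable_compose[OF _ fst_borel_measurable]) auto
  have X: "Piprod b \<eta> (\<lambda>i. a i \<omega>) k *v v = G (\<lambda>i\<in>{..b * k}. Z i \<omega>)" for \<omega>
    unfolding Piprod_mult_vec G_def by (intro xseq_cong) (auto simp: Z_def)
  from nn_integral_Mmat_step[OF G X e p] show ?case
    by (simp add: matrix_vector_mul_assoc [symmetric] Suc.IH mult.assoc)
qed

section \<open>Identification of \<open>hfun\<close> with the directional moment\<close>

lemma measurable_specnorm_Piprod [measurable]: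
  "(\<lambda>\<omega>. specnorm (Piprod b \<eta> (\<lambda>i. a i \<omega>) k)) \<in> borel_measurable M"
  using measurable_a
  by (intro measurable_compose[OF _ specnorm_measurable] borel_measurable_matrix)
    (auto simp: Piprod_mult_vec intro!: xseq_measurable)

text \<open>The lower bound tests the operator on \<open>e\<close>; the upper bound sums over
  columns, each having moment \<open>moment p e ^ k\<close>. The factor between the two does not
  depend on \<open>k\<close>.\<close>

lemma specnorm_moment_bounds:
  assumes e: "norm e = 1" and p: "0 < p"
  defines "S \<equiv> \<lambda>k. \<integral>\<^sup>+\<omega>. ennreal (specnorm (Piprod b \<eta> (\<lambda>i. a i \<omega>) k) powr p) \<partial>M"
  shows "moment p e ^ k \<le> S k"
    and "S k \<le> ennreal (real CARD('d) powr p * real CARD('d)) * moment p e ^ k"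
proof -
  have "moment p e ^ k = (\<integral>\<^sup>+\<omega>. ennreal (norm (Piprod b \<eta> (\<lambda>i. a i \<omega>) k *v e) powr p) \<partial>M)"
    using nn_integral_Piprod[OF e p, of k e] e by simp
  also have "\<dots> \<le> S k"
    unfolding S_def using p e
    by (intro nn_integral_mono ennreal_leI powr_mono2) (use specnorm_bound[of _ e] in auto)
  finally show "moment p e ^ k \<le> S k" .
  have "S k \<le> (\<integral>\<^sup>+\<omega>. ennreal (real CARD('d) powr p) *
      (\<Sum>j\<in>UNIV. ennreal (norm (Piprod b \<eta> (\<lambda>i. a i \<omega>) k *v axis j 1) powr p)) \<partial>M)"
    unfolding S_def
  proof (intro nn_integral_mono)
    fix \<omega>
    let ?A = "Piprod b \<eta> (\<lambda>i. a i \<omega>) k"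
    have "specnorm ?A powr p \<le> (\<Sum>j\<in>UNIV. norm (?A *v axis j 1)) powr p"
      using p by (intro powr_mono2 specnorm_le_sum_columns specnorm_nonneg) auto
    also have "\<dots> \<le> real CARD('d) powr p * (\<Sum>j\<in>UNIV. norm (?A *v axis j 1) powr p)"
      using p by (intro sum_powr_le) auto
    finally show "ennreal (specnorm ?A powr p) \<le>
        ennreal (real CARD('d) powr p) * (\<Sum>j\<in>UNIV. ennreal (norm (?A *v axis j 1) powr p))"
      by (simp add: ennreal_mult' [symmetric] sum_nonneg ennreal_leI)
  qed
  also have "\<dots> = ennreal (real CARD('d) powr p) *
      (\<Sum>j\<in>UNIV. \<integral>\<^sup>+\<omega>. ennreal (norm (Piprod b \<eta> (\<lambda>i. a i \<omega>) k *v axis j 1) powr p) \<partial>M)"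
  proof -
    have m [measurable]: "(\<lambda>\<omega>. ennreal (norm (Piprod b \<eta> (\<lambda>i. a i \<omega>) k *v axis j 1) powr p)) \<in> borel_measurable M" for j
      using measurable_a unfolding Piprod_mult_vec by (intro norm_powr_measurable xseq_measurable) auto
    show ?thesis
      by (subst nn_integral_cmult, measurable, subst nn_integral_sum, rule m, simp)
  qed
  also have "\<dots> = ennreal (real CARD('d) powr p * real CARD('d)) * moment p e ^ k"
    by (simp add: nn_integral_Piprod[OF e p] ennreal_mult mult.assoc ennreal_of_nat_eq_real_of_nat)
  finally show "S k \<le> ennreal (real CARD('d) powr p * real CARD('d)) * moment p e ^ k" .
qed

text \<open>Holds without integrability: if the right-hand integral is infinite, both sides are
  0.\<close>

lemma integral_specnorm_eq:
  "(\<integral>\<omega>. specnorm (Piprod b \<eta> (\<lambda>i. a i \<omega>) k) powr p \<partial>M) =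
   enn2real (\<integral>\<^sup>+\<omega>. ennreal (specnorm (Piprod b \<eta> (\<lambda>i. a i \<omega>) k) powr p) \<partial>M)"
  by (rule integral_eq_nn_integral) auto

text \<open>If the moment is infinite, the Bochner integrals in the definition of \<open>hfun\<close> take the junk value 0.\<close>
lemma moment_finite:
  assumes e: "norm e = 1" and p: "0 < p" and h: "hfun M b \<eta> a p \<noteq> 0"
  shows "moment p e < \<infinity>"
proof (rule ccontr)
  assume "\<not> moment p e < \<infinity>"
  then have top: "moment p e = \<infinity>" by (simp add: not_less top_unique)
  \<comment> \<open>The case \<open>k = 0\<close> is excluded because the zeroth power of infinity
    is 1.\<close>
  have "(\<integral>\<omega>. specnorm (Piprod b \<eta> (\<lambda>i. a i \<omega>) k) powr p \<partial>M) = 0" if "k \<ge> 1" for k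
    using specnorm_moment_bounds(1)[OF e p, of k] that
    by (simp add: integral_specnorm_eq top top_power_ennreal top_unique)
  then have "\<forall>\<^sub>F k in sequentially.
      (\<integral>\<omega>. specnorm (Piprod b \<eta> (\<lambda>i. a i \<omega>) k) powr p \<partial>M) powr (1 / real k) = 0"
    by (auto simp: eventually_sequentially intro!: exI[of _ 1])
  then have "hfun M b \<eta> a p = 0"
    unfolding hfun_def by (intro limI tendsto_eventually)
  then show False using h by simp
qed

text \<open>The \<open>k\<close>-th root of the specnorm moment is squeezed between \<open>m\<close>
  and \<open>C powr (1 / real k) * m\<close>, and \<open>C powr (1 / real k)\<close> tends to
  1.\<close>

lemma hfun_eq_moment:
  assumes e: "norm e = 1" and p: "0 < p" and fin: "moment p e < \<infinity>"
  shows "ennreal (hfun M b \<eta> a p) = moment p e" "hfun M b \<eta> a p \<ge> 0"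
proof -
  define m C where "m = enn2real (moment p e)" and "C = real CARD('d) powr p * real CARD('d)"
  define I where "I k = (\<integral>\<omega>. specnorm (Piprod b \<eta> (\<lambda>i. a i \<omega>) k) powr p \<partial>M)" for k
  have C: "C > 0" by (simp add: C_def)
  have m: "m \<ge> 0" "moment p e = ennreal m" using fin by (auto simp: m_def)
  have I: "m ^ k \<le> I k" "I k \<le> C * m ^ k" for k
  proof -
    let ?S = "\<integral>\<^sup>+\<omega>. ennreal (specnorm (Piprod b \<eta> (\<lambda>i. a i \<omega>) k) powr p) \<partial>M"
    have S: "ennreal (m ^ k) \<le> ?S" "?S \<le> ennreal (C * m ^ k)"
      using specnorm_moment_bounds[OF e p, of k] m C by (simp_all add: C_def ennreal_power ennreal_mult)
    then have "?S = ennreal (I k)"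
      unfolding I_def integral_specnorm_eq by (subst ennreal_enn2real) (auto simp: less_top [symmetric] top_unique)
    moreover have "I k \<ge> 0" by (simp add: I_def)
    ultimately show "m ^ k \<le> I k" "I k \<le> C * m ^ k" using S m C by auto
  qed
  have root: "(m ^ k) powr (1 / real k) = m" if "k \<ge> 1" for k
    using that m by (cases "m = 0") (auto simp: powr_realpow [symmetric] powr_powr)
  have lim: "(\<lambda>k. I k powr (1 / real k)) \<longlonglongrightarrow> m"
  proof (rule tendsto_sandwich)
    show "\<forall>\<^sub>F k in sequentially. m \<le> I k powr (1 / real k)"
    proof (rule eventually_sequentiallyI[of 1])
      fix k :: nat assume k: "1 \<le> k"
      have "(m ^ k) powr (1 / real k) \<le> I k powr (1 / real k)" using I m by (intro powr_mono2) auto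
      then show "m \<le> I k powr (1 / real k)" by (simp only: root[OF k])
    qed
    show "\<forall>\<^sub>F k in sequentially. I k powr (1 / real k) \<le> C powr (1 / real k) * m"
    proof (rule eventually_sequentiallyI[of 1])
      fix k :: nat assume k: "1 \<le> k"
      have "0 \<le> I k" using I(1)[of k] m by (meson order_trans zero_le_power)
      then have "I k powr (1 / real k) \<le> (C * m ^ k) powr (1 / real k)" using I by (intro powr_mono2) auto
      also have "\<dots> = C powr (1 / real k) * m" using C m by (simp add: powr_mult root[OF k])
      finally show "I k powr (1 / real k) \<le> C powr (1 / real k) * m" .
    qed
    have "(\<lambda>k. C powr (1 / real k)) \<longlonglongrightarrow> C powr 0"
      using C by (intro tendsto_powr tendsto_const lim_1_over_n) auto
    from tendsto_mult[OF this tendsto_const[of m]] C show "(\<lambda>k. C powr (1 / real k) * m) \<longlonglongrightarrow> m" by simp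
  qed simp
  then have "hfun M b \<eta> a p = m" unfolding hfun_def I_def by (rule limI)
  then show "ennreal (hfun M b \<eta> a p) = moment p e" "hfun M b \<eta> a p \<ge> 0" using m by simp_all
qed

section \<open>Strict contraction with positive probability, and \<open>hfun\<close> below the tail
  index\<close>

lemma Mmat_contracts:
  fixes v :: "nat \<Rightarrow> real^'d"
  assumes e: "norm e = 1"
    and v: "\<And>i. i \<in> {1..b} \<Longrightarrow> (norm (v i))\<^sup>2 \<le> 1 / \<eta>" "\<And>i. i \<in> {1..b} \<Longrightarrow> v i \<bullet> e \<noteq> 0"
  shows "norm (Mmat b \<eta> v 1 *v e) < 1"
proof -
  \<comment> \<open>The squared norm of the image is a quadratic in the stepsize: its linear term is
    \<open>- 2 * (\<eta> / real b) * T\<close>, and Cauchy-Schwarz with the size bound on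
    \<open>v\<close> keeps the quadratic term below half of that in modulus.\<close>
  define S T where "S = (\<Sum>i\<in>{1..b}. (v i \<bullet> e) *\<^sub>R v i)" and "T = (\<Sum>i\<in>{1..b}. (v i \<bullet> e)\<^sup>2)"
  have T: "T > 0" unfolding T_def using b v(2) by (intro sum_pos) auto
  have eS: "e \<bullet> S = T"
    by (simp add: S_def T_def inner_sum_right power2_eq_square inner_commute)
  have "(norm S)\<^sup>2 \<le> (\<Sum>i\<in>{1..b}. \<bar>v i \<bullet> e\<bar> * norm (v i))\<^sup>2"
    unfolding S_def by (intro power_mono sum_norm_le) auto
  also have "\<dots> \<le> (\<Sum>i\<in>{1..b}. (\<bar>v i \<bullet> e\<bar> * norm (v i))\<^sup>2) * real b"
    using sum_squared_le_sum_of_squares[of "\<lambda>i. \<bar>v i \<bullet> e\<bar> * norm (v i)" "{1..b}"] by simp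
  also have "\<dots> \<le> (\<Sum>i\<in>{1..b}. (v i \<bullet> e)\<^sup>2 * (1 / \<eta>)) * real b"
    unfolding power_mult_distrib power2_abs using v(1) by (intro mult_right_mono sum_mono mult_left_mono) auto
  also have "\<dots> = T * real b / \<eta>" by (simp add: T_def sum_distrib_right sum_divide_distrib)
  finally have S: "(norm S)\<^sup>2 \<le> T * real b / \<eta>" .
  have "(norm (Mmat b \<eta> v 1 *v e))\<^sup>2 = (norm (e - (\<eta> / real b) *\<^sub>R S))\<^sup>2"
    by (simp add: Mmat_mult_vec S_def)
  also have "\<dots> = 1 - 2 * (\<eta> / real b) * T + (\<eta> / real b)\<^sup>2 * (norm S)\<^sup>2"
    using e by (simp only: power2_norm_eq_inner)
      (simp add: eS inner_commute[of S e] norm_eq_1 power2_eq_square algebra_simps)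
  also have "\<dots> \<le> 1 - 2 * (\<eta> / real b) * T + (\<eta> / real b)\<^sup>2 * (T * real b / \<eta>)"
    using S by (intro add_left_mono mult_left_mono) auto
  also have "\<dots> = 1 - \<eta> / real b * T"
    using b eta by (simp add: power2_eq_square field_simps)
  also have "\<dots> < 1" using b eta T by simp
  finally have "(norm (Mmat b \<eta> v 1 *v e))\<^sup>2 < 1\<^sup>2" by simp
  then show ?thesis by (rule power2_less_imp_less) simp
qed

text \<open>The Gaussian density vanishes nowhere, so a set of probability zero is Lebesgue null,
  which no nonempty open set is.\<close>

lemma prob_a_in_open_pos:
  assumes "i \<ge> 1" "open U" "U \<noteq> {}"
  shows "prob (a i -` U \<inter> space M) > 0"
proof (rule ccontr)
  let ?g = "\<lambda>v::real^'d. ennreal (\<Prod>j\<in>UNIV. normal_density 0 \<sigma> (v $ j))"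
  assume "\<not> prob (a i -` U \<inter> space M) > 0"
  then have "prob (a i -` U \<inter> space M) = 0" using measure_nonneg[of M "a i -` U \<inter> space M"] by linarith
  then have "emeasure (distr M lborel (a i)) U = 0"
    using measurable_a[OF assms(1)] assms(2) by (simp add: emeasure_distr emeasure_eq_measure)
  then have "U \<in> null_sets (density lborel ?g)"
    using distributed_distr_eq_density[OF gaussian[OF assms(1)]] assms(2) by (simp add: null_sets_def)
  moreover have "?g \<in> borel_measurable lborel"
    using gaussian[OF assms(1)] by (auto dest: distributed_borel_measurable)
  ultimately have "AE x in lborel. x \<in> U \<longrightarrow> ?g x = 0"
    by (simp add: null_sets_density_iff)
  moreover have "?g x \<noteq> 0" for x
    using sigma by (simp add: ennreal_eq_0_iff not_le prod_pos normal_density_pos)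
  ultimately have "AE x in lborel. x \<notin> U" by simp
  then have "U \<in> null_sets lborel" using assms(2) by (subst AE_iff_null_sets) auto
  then show False
    using open_not_null_lborel[OF assms(2,3)] by simp
qed

text \<open>By independence, all vectors of the first batch lie in one open set of contracting data
  with positive probability.\<close>

lemma not_AE_isometric:
  assumes e: "norm e = 1"
  shows "\<not> (AE \<omega> in M. norm (Mmat b \<eta> (\<lambda>i. a i \<omega>) 1 *v e) = 1)"
proof
  assume AE: "AE \<omega> in M. norm (Mmat b \<eta> (\<lambda>i. a i \<omega>) 1 *v e) = 1"
  define U where "U = ball 0 (sqrt (1 / \<eta>)) \<inter> {v. v \<bullet> e \<noteq> 0}"
  have U: "open U" unfolding U_def
    by (intro open_Int open_ball open_Collect_neq continuous_intros)
  \<comment> \<open>Half the radius in direction \<open>e\<close> stays inside the ball and has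
    nonzero inner product with \<open>e\<close>.\<close>
  have "(sqrt (1 / \<eta>) / 2) *\<^sub>R e \<in> U" using e eta dot_square_norm[of e] by (simp add: U_def)
  then have U0: "U \<noteq> {}" by blast
  define E where "E = (\<Inter>i\<in>{1..b}. a i -` U \<inter> space M)"
  have "indep_vars (\<lambda>_. borel) a {1..b}" by (rule indep_a)
  then have "prob E = (\<Prod>i\<in>{1..b}. prob (a i -` U \<inter> space M))"
    unfolding E_def using b U by (intro indep_varsD_finite[where M'="\<lambda>_. borel"]) auto
  also have "\<dots> > 0" using prob_a_in_open_pos[OF _ U U0] by (intro prod_pos) auto
  finally have pos: "prob E > 0" .
  have "a i -` U \<inter> space M \<in> events" if "i \<in> {1..b}" for i
    using measurable_sets[OF measurable_a, of i U] U that by auto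
  then have E: "E \<in> events" unfolding E_def using b by (intro sets.finite_INT) auto
  have "norm (Mmat b \<eta> (\<lambda>i. a i \<omega>) 1 *v e) < 1" if "\<omega> \<in> E" for \<omega>
  proof (rule Mmat_contracts[OF e])
    fix i assume "i \<in> {1..b}"
    then have "a i \<omega> \<in> U" using that by (auto simp: E_def)
    then show "(norm (a i \<omega>))\<^sup>2 \<le> 1 / \<eta>" "a i \<omega> \<bullet> e \<noteq> 0"
      using eta power_mono[of "norm (a i \<omega>)" "sqrt (1 / \<eta>)" 2] by (auto simp: U_def)
  qed
  then have "AE \<omega> in M. \<omega> \<notin> E" using AE by (fastforce elim!: eventually_mono)
  then have "prob E = 0" using E by (simp add: prob_eq_0)
  then show False using pos by simp
qed

text \<open>Taking expectations in the affine bound gives at most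
  \<open>p / \<alpha> + (1 - p / \<alpha>) = 1\<close>; equality would force norm 1 almost surely,
  which \<open>not_AE_isometric\<close> excludes. The same bound yields integrability at
  \<open>p\<close>.\<close>

lemma hfun_less_1:
  assumes e: "norm e = 1" and p: "0 < p" "p < \<alpha>" and h: "hfun M b \<eta> a \<alpha> = 1"
  shows "moment p e < \<infinity>" "hfun M b \<eta> a p < 1"
proof -
  define x where "x \<omega> = norm (Mmat b \<eta> (\<lambda>i. a i \<omega>) 1 *v e)" for \<omega>
  have x [measurable]: "x \<in> borel_measurable M"
    unfolding x_def using measurable_a
    by (intro measurable_compose[OF _ borel_measurable_norm] Mmat_mult_measurable) auto
  have x0: "x \<omega> \<ge> 0" for \<omega> by (simp add: x_def)
  have mom: "moment q e = (\<integral>\<^sup>+\<omega>. ennreal (x \<omega> powr q) \<partial>M)" for q by (simp add: moment_def x_def)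
  have \<alpha>: "0 < \<alpha>" using p by simp
  \<comment> \<open>The value 1 of \<open>hfun\<close> at \<alpha> is nonzero, hence not a default
    produced by an infinite moment.\<close>
  have "moment \<alpha> e < \<infinity>" using moment_finite[OF e \<alpha>] h by simp
  then have one: "moment \<alpha> e = 1" using hfun_eq_moment(1)[OF e \<alpha>] h by simp
  have int_\<alpha>: "integrable M (\<lambda>\<omega>. x \<omega> powr \<alpha>)"
    using one by (intro integrableI_nonneg) (auto simp: mom)
  have I_\<alpha>: "(\<integral>\<omega>. x \<omega> powr \<alpha> \<partial>M) = 1"
    using one by (subst integral_eq_nn_integral) (auto simp: mom)
  have less: "x \<omega> powr p < p / \<alpha> * x \<omega> powr \<alpha> + (1 - p / \<alpha>)" if "x \<omega> \<noteq> 1" for \<omega>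
    using powr_less_affine[OF x0 that p] .
  have le: "x \<omega> powr p \<le> p / \<alpha> * x \<omega> powr \<alpha> + (1 - p / \<alpha>)" for \<omega>
    using less[of \<omega>] by (cases "x \<omega> = 1") auto
  have int_aff: "integrable M (\<lambda>\<omega>. p / \<alpha> * x \<omega> powr \<alpha> + (1 - p / \<alpha>))"
    using int_\<alpha> by simp
  have int_p: "integrable M (\<lambda>\<omega>. x \<omega> powr p)"
    using le by (intro Bochner_Integration.integrable_bound[OF int_aff] AE_I2)
      (auto intro: order_trans[OF _ abs_ge_self])
  \<comment> \<open>\<open>D\<close> is the gap in the affine bound: nonnegative, with mean 1 minus
    the \<open>p\<close>-th moment, and zero only where \<open>x \<omega> = 1\<close>.\<close>
  define D where "D \<omega> = p / \<alpha> * x \<omega> powr \<alpha> + (1 - p / \<alpha>) - x \<omega> powr p" for \<omega>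
  have int_D: "integrable M D" unfolding D_def using int_aff int_p by simp
  have D0: "D \<omega> \<ge> 0" for \<omega> using le[of \<omega>] by (simp add: D_def)
  have "(\<integral>\<omega>. D \<omega> \<partial>M) = 1 - (\<integral>\<omega>. x \<omega> powr p \<partial>M)"
    unfolding D_def using int_\<alpha> int_p I_\<alpha> by (simp add: prob_space)
  moreover have "(\<integral>\<omega>. D \<omega> \<partial>M) \<noteq> 0"
  proof
    assume "(\<integral>\<omega>. D \<omega> \<partial>M) = 0"
    then have "AE \<omega> in M. D \<omega> = 0"
      using integral_nonneg_eq_0_iff_AE[OF int_D] D0 by simp
    then have "AE \<omega> in M. x \<omega> = 1"
      using less by (auto simp: D_def elim!: eventually_mono) fastforce
    then show False using not_AE_isometric[OF e] by (simp add: x_def)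
  qed
  moreover have "(\<integral>\<omega>. D \<omega> \<partial>M) \<ge> 0" using D0 by simp
  ultimately have lt: "(\<integral>\<omega>. x \<omega> powr p \<partial>M) < 1" by simp
  have mp: "moment p e = ennreal (\<integral>\<omega>. x \<omega> powr p \<partial>M)"
    unfolding mom using int_p by (intro nn_integral_eq_integral) auto
  then show fin: "moment p e < \<infinity>" by simp
  have "ennreal (hfun M b \<eta> a p) < ennreal 1"
    using lt by (simp add: hfun_eq_moment(1)[OF e p(1) fin] mp)
  then show "hfun M b \<eta> a p < 1"
    using hfun_eq_moment(2)[OF e p(1) fin] by (simp add: ennreal_less_iff)
qed

text \<open>Each step multiplies the moment bound by \<open>r\<close> and adds \<open>C\<close>
  times the moment of \<open>qvec\<close>; iteration yields a geometric sum. The constants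
  \<open>c\<close> and \<open>C\<close> are left open so that both ranges of \<open>p\<close> are
  instances.\<close>

lemma xseq_moment_bound:
  assumes p: "0 < p" and fin: "moment p e < \<infinity>" and e: "norm e = 1"
    and c: "0 \<le> c" "0 \<le> C" and r: "c * hfun M b \<eta> a p < 1"
    and add: "\<And>u v. 0 \<le> u \<Longrightarrow> 0 \<le> v \<Longrightarrow> (u + v) powr p \<le> c * u powr p + C * v powr p"
  defines "r \<equiv> c * hfun M b \<eta> a p"
  shows "(\<integral>\<^sup>+\<omega>. ennreal (norm (xseq b \<eta> (\<lambda>i. a i \<omega>) (\<lambda>i. y i \<omega>) (x0 \<omega>) k) powr p) \<partial>M)
      \<le> ennreal (r ^ k) * (\<integral>\<^sup>+\<omega>. ennreal (norm (x0 \<omega>) powr p) \<partial>M)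
        + ennreal ((1 - r ^ k) / (1 - r) * C)
          * (\<integral>\<^sup>+\<omega>. ennreal (norm (qvec b \<eta> (\<lambda>i. a i \<omega>) (\<lambda>i. y i \<omega>) 1) powr p) \<partial>M)"
    (is "?T k \<le> _ * ?I + _ * ?Q")
proof (induction k)
  case 0
  then show ?case by simp
next
  case (Suc k)
  note h = hfun_eq_moment[OF e p fin]
  have r01: "0 \<le> r" "r < 1" using c h(2) r by (auto simp: r_def)
  let ?x = "\<lambda>\<omega>. xseq b \<eta> (\<lambda>i. a i \<omega>) (\<lambda>i. y i \<omega>) (x0 \<omega>) k"
  let ?M = "\<lambda>\<omega>. Mmat b \<eta> (\<lambda>i. a i \<omega>) (Suc k) *v ?x \<omega>"
  let ?q = "\<lambda>\<omega>. qvec b \<eta> (\<lambda>i. a i \<omega>) (\<lambda>i. y i \<omega>) (Suc k)"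
  \<comment> \<open>The iterate as a function of the indices up to \<open>b * k\<close>, with the
    initial value read at index 0, as the step lemma requires.\<close>
  define G where "G w = xseq b \<eta> (\<lambda>i. fst (w i)) (\<lambda>i. snd (w i)) (fst (w 0)) k"
    for w :: "nat \<Rightarrow> (real^'d) \<times> real"
  have G: "G \<in> borel_measurable (PiM {..b * k} (\<lambda>_. borel))"
    unfolding G_def
    by (intro xseq_measurable measurable_compose[OF _ fst_borel_measurable] measurable_compose[OF _ snd_borel_measurable]) auto
  have X: "?x \<omega> = G (\<lambda>i\<in>{..b * k}. Z i \<omega>)" for \<omega>
  proof -
    have "fst ((\<lambda>i\<in>{..b * k}. Z i \<omega>) 0) = x0 \<omega>" by (simp add: Z_def)
    then show ?thesis unfolding G_def by (simp only:) (intro xseq_cong, auto simp: Z_def)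
  qed
  have mM: "?M \<in> borel_measurable M"
    using measurable_a measurable_y measurable_x0 by (intro Mmat_mult_measurable xseq_measurable) auto
  have mq: "?q \<in> borel_measurable M"
    using measurable_a measurable_y by (intro qvec_measurable) auto
  note [measurable] = norm_powr_measurable[OF mM] norm_powr_measurable[OF mq]
  have "?T (Suc k) \<le> (\<integral>\<^sup>+\<omega>. ennreal c * ennreal (norm (?M \<omega>) powr p) + ennreal C * ennreal (norm (?q \<omega>) powr p) \<partial>M)"
  proof (intro nn_integral_mono)
    fix \<omega>
    have "norm (xseq b \<eta> (\<lambda>i. a i \<omega>) (\<lambda>i. y i \<omega>) (x0 \<omega>) (Suc k)) powr p \<le> (norm (?M \<omega>) + norm (?q \<omega>)) powr p"
      using p by (intro powr_mono2) (auto intro: norm_triangle_ineq)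
    also have "\<dots> \<le> c * norm (?M \<omega>) powr p + C * norm (?q \<omega>) powr p" by (intro add) auto
    finally show "ennreal (norm (xseq b \<eta> (\<lambda>i. a i \<omega>) (\<lambda>i. y i \<omega>) (x0 \<omega>) (Suc k)) powr p) \<le>
        ennreal c * ennreal (norm (?M \<omega>) powr p) + ennreal C * ennreal (norm (?q \<omega>) powr p)"
      using c by (simp add: ennreal_mult [symmetric] ennreal_plus [symmetric] ennreal_leI del: ennreal_plus xseq.simps)
  qed
  also have "\<dots> = ennreal c * (\<integral>\<^sup>+\<omega>. ennreal (norm (?M \<omega>) powr p) \<partial>M) + ennreal C * (\<integral>\<^sup>+\<omega>. ennreal (norm (?q \<omega>) powr p) \<partial>M)"
    by (subst nn_integral_add) (simp_all only: nn_integral_cmult norm_powr_measurable mM mq borel_measurable_times_ennreal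
        borel_measurable_const)
  also have "\<dots> = ennreal r * ?T k + ennreal C * ?Q"
    unfolding nn_integral_Mmat_step[OF G X e p] nn_integral_qvec_stationary[of k p] h(1) [symmetric] r_def
    using c h(2) by (simp add: ennreal_mult mult.assoc)
  also have "\<dots> \<le> ennreal r * (ennreal (r ^ k) * ?I + ennreal ((1 - r ^ k) / (1 - r) * C) * ?Q) + ennreal C * ?Q"
    by (intro add_right_mono mult_left_mono Suc.IH) simp
  also have "\<dots> = ennreal (r ^ Suc k) * ?I + ennreal (r * ((1 - r ^ k) / (1 - r) * C) + C) * ?Q"
  proof -
    have "0 \<le> (1 - r ^ k) / (1 - r) * C" using r01 c by (simp add: power_le_one)
    then show ?thesis
      using r01 c by (simp add: ennreal_mult distrib_left distrib_right mult.assoc add.assoc del: times_divide_eq_left)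
  qed
  \<comment> \<open>The closed form of the geometric sum advances by one term.\<close>
  also have "r * ((1 - r ^ k) / (1 - r) * C) + C = (1 - r ^ Suc k) / (1 - r) * C"
    using r01 by (simp add: field_simps)
  finally show ?case .
qed

end

theorem theorem5:
  fixes M :: "'w measure"
    and a :: "nat \<Rightarrow> 'w \<Rightarrow> real^'d"
    and y :: "nat \<Rightarrow> 'w \<Rightarrow> real"
    and x0 :: "'w \<Rightarrow> real^'d"
    and b :: nat and \<eta> \<sigma> \<rho> \<alpha> :: real
  assumes P: "prob_space M"
    and b: "b \<ge> 1" and eta: "\<eta> > 0" and sigma: "\<sigma> > 0"
    \<comment> \<open>x_0 and the data pairs (a_i,y_i), i \<ge> 1, are mutually independent\<close>
    and indep: "prob_space.indep_vars M (\<lambda>_. borel)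
                  (\<lambda>i \<omega>. if i = 0 then (x0 \<omega>, 0) else (a i \<omega>, y i \<omega>)) UNIV"
    \<comment> \<open>the data pairs are identically distributed\<close>
    and ident: "\<And>i. i \<ge> 1 \<Longrightarrow>
                  distr M borel (\<lambda>\<omega>. (a i \<omega>, y i \<omega>)) = distr M borel (\<lambda>\<omega>. (a 1 \<omega>, y 1 \<omega>))"
    \<comment> \<open>(A2)\<close>
    and A2: "\<exists>f. continuous_on UNIV f \<and> (\<forall>t. f t \<ge> 0) \<and> closure {t. f t > 0} = UNIV \<and>
               (\<forall>i\<ge>1. distributed M lborel (y i) (\<lambda>t. ennreal (f t)))"
    and A2_moments: "\<And>i n. i \<ge> 1 \<Longrightarrow> integrable M (\<lambda>\<omega>. \<bar>y i \<omega>\<bar> ^ n)"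
    \<comment> \<open>(A3)\<close>
    and A3: "\<And>i. i \<ge> 1 \<Longrightarrow> distributed M lborel (a i)
                  (\<lambda>v. ennreal (\<Prod>j\<in>UNIV. normal_density 0 \<sigma> (v $ j)))"
    \<comment> \<open>\<rho> < 0, \<rho> being the almost sure Lyapunov exponent\<close>
    and rho: "AE \<omega> in M. (\<lambda>k. ln (lambda_max (transpose (Piprod b \<eta> (\<lambda>i. a i \<omega>) k)
                                   ** Piprod b \<eta> (\<lambda>i. a i \<omega>) k)) / (2 * real k)) \<longlonglongrightarrow> \<rho>"
    and rho_neg: "\<rho> < 0"
    \<comment> \<open>\<alpha> is the tail index\<close>
    and alpha: "\<alpha> > 0" "hfun M b \<eta> a \<alpha> = 1"
  shows
    "(\<alpha> \<le> 1 \<longrightarrow> (\<forall>p. 0 < p \<and> p < \<alpha> \<longrightarrow>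
        hfun M b \<eta> a p < 1 \<and>
        (\<forall>k\<ge>1. (\<integral>\<^sup>+\<omega>. ennreal (norm (xseq b \<eta> (\<lambda>i. a i \<omega>) (\<lambda>i. y i \<omega>) (x0 \<omega>) k) powr p) \<partial>M)
           \<le> ennreal (hfun M b \<eta> a p ^ k) * (\<integral>\<^sup>+\<omega>. ennreal (norm (x0 \<omega>) powr p) \<partial>M)
             + ennreal ((1 - hfun M b \<eta> a p ^ k) / (1 - hfun M b \<eta> a p))
               * (\<integral>\<^sup>+\<omega>. ennreal (norm (qvec b \<eta> (\<lambda>i. a i \<omega>) (\<lambda>i. y i \<omega>) 1) powr p) \<partial>M))))
   \<and> (\<alpha> > 1 \<longrightarrow> (\<forall>p. 1 < p \<and> p < \<alpha> \<longrightarrow>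
        hfun M b \<eta> a p < 1 \<and>
        (\<forall>\<epsilon>. 0 < \<epsilon> \<and> \<epsilon> < 1 / hfun M b \<eta> a p - 1 \<longrightarrow>
         (\<forall>k\<ge>1. (\<integral>\<^sup>+\<omega>. ennreal (norm (xseq b \<eta> (\<lambda>i. a i \<omega>) (\<lambda>i. y i \<omega>) (x0 \<omega>) k) powr p) \<partial>M)
           \<le> ennreal (((1 + \<epsilon>) * hfun M b \<eta> a p) ^ k) * (\<integral>\<^sup>+\<omega>. ennreal (norm (x0 \<omega>) powr p) \<partial>M)
             + ennreal ((1 - ((1 + \<epsilon>) * hfun M b \<eta> a p) ^ k) / (1 - (1 + \<epsilon>) * hfun M b \<eta> a p)
                 * (((1 + \<epsilon>) powr (p / (p - 1)) - (1 + \<epsilon>)) / ((1 + \<epsilon>) powr (1 / (p - 1)) - 1) powr p))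
               * (\<integral>\<^sup>+\<omega>. ennreal (norm (qvec b \<eta> (\<lambda>i. a i \<omega>) (\<lambda>i. y i \<omega>) 1) powr p) \<partial>M)))))"
proof -
  interpret gaussian_sgd M a y x0 b \<eta> \<sigma>
    using P by (intro gaussian_sgd.intro gaussian_sgd_axioms.intro b eta sigma indep ident A3)
  obtain e :: "real^'d" where e: "norm e = 1"
    using vector_choose_size[of 1] by auto
  show ?thesis
  proof (intro conjI impI allI)
    fix p k assume "\<alpha> \<le> 1" and "0 < p \<and> p < \<alpha>"
    then have p: "0 < p" "p < \<alpha>" "p \<le> 1" by auto
    note h = hfun_less_1[OF e p(1,2) alpha(2)]
    show "hfun M b \<eta> a p < 1" by (fact h(2))
    show "(\<integral>\<^sup>+\<omega>. ennreal (norm (xseq b \<eta> (\<lambda>i. a i \<omega>) (\<lambda>i. y i \<omega>) (x0 \<omega>) k) powr p) \<partial>M)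
           \<le> ennreal (hfun M b \<eta> a p ^ k) * (\<integral>\<^sup>+\<omega>. ennreal (norm (x0 \<omega>) powr p) \<partial>M)
             + ennreal ((1 - hfun M b \<eta> a p ^ k) / (1 - hfun M b \<eta> a p))
               * (\<integral>\<^sup>+\<omega>. ennreal (norm (qvec b \<eta> (\<lambda>i. a i \<omega>) (\<lambda>i. y i \<omega>) 1) powr p) \<partial>M)"
    proof -
      have "(u + v) powr p \<le> 1 * u powr p + 1 * v powr p" if "0 \<le> u" "0 \<le> v" for u v
        using powr_add_le[of u v p] that p by simp
      from xseq_moment_bound[OF p(1) h(1) e _ _ _ this, of k] h(2) show ?thesis by simp
    qed
  next
    fix p assume "1 < \<alpha>" and "1 < p \<and> p < \<alpha>"
    then have p: "1 < p" "0 < p" "p < \<alpha>" by auto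
    note h = hfun_less_1[OF e p(2,3) alpha(2)]
    show "hfun M b \<eta> a p < 1" by (fact h(2))
    have h0: "hfun M b \<eta> a p \<ge> 0" by (rule hfun_eq_moment(2)[OF e p(2) h(1)])
    fix \<epsilon> k assume "0 < \<epsilon> \<and> \<epsilon> < 1 / hfun M b \<eta> a p - 1"
    then have \<epsilon>: "0 < \<epsilon>" "1 + \<epsilon> < 1 / hfun M b \<eta> a p" by auto
    define C where "C = ((1 + \<epsilon>) powr (p / (p - 1)) - (1 + \<epsilon>)) / ((1 + \<epsilon>) powr (1 / (p - 1)) - 1) powr p"
    \<comment> \<open>The case of a zero \<open>hfun\<close> is split off since the bound on
      \<epsilon> can be multiplied out only for a positive denominator.\<close>
    have r: "(1 + \<epsilon>) * hfun M b \<eta> a p < 1"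
      using \<epsilon> h0 by (cases "hfun M b \<eta> a p = 0") (auto simp: pos_less_divide_eq)
    have add: "(u + v) powr p \<le> (1 + \<epsilon>) * u powr p + C * v powr p" if "0 \<le> u" "0 \<le> v" for u v
      unfolding C_def using that p \<epsilon> by (intro powr_add_le_eps) auto
    \<comment> \<open>Setting \<open>u = 0\<close> and \<open>v = 1\<close> in the inequality even
      shows that \<open>C\<close> is at least 1.\<close>
    have C: "C \<ge> 0" using add[of 0 1] by simp
    show "(\<integral>\<^sup>+\<omega>. ennreal (norm (xseq b \<eta> (\<lambda>i. a i \<omega>) (\<lambda>i. y i \<omega>) (x0 \<omega>) k) powr p) \<partial>M)
           \<le> ennreal (((1 + \<epsilon>) * hfun M b \<eta> a p) ^ k) * (\<integral>\<^sup>+\<omega>. ennreal (norm (x0 \<omega>) powr p) \<partial>M)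
             + ennreal ((1 - ((1 + \<epsilon>) * hfun M b \<eta> a p) ^ k) / (1 - (1 + \<epsilon>) * hfun M b \<eta> a p)
                 * (((1 + \<epsilon>) powr (p / (p - 1)) - (1 + \<epsilon>)) / ((1 + \<epsilon>) powr (1 / (p - 1)) - 1) powr p))
               * (\<integral>\<^sup>+\<omega>. ennreal (norm (qvec b \<eta> (\<lambda>i. a i \<omega>) (\<lambda>i. y i \<omega>) 1) powr p) \<partial>M)"
      unfolding C_def [symmetric]
      by (rule xseq_moment_bound[OF p(2) h(1) e _ C r add]) (use \<epsilon> in simp)
  qed
qed

end
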